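(* Let $\mathfrak{X}=(Q,\Gamma)$ be an association scheme on $Q=\{1,\dots,d\}$ and let $t\in\mathbb{N}$ with $1\le t\le d-2$ be such that $\mathfrak{X}$ is extensible to height $t$. Then on input $(\mathfrak{X},t)$ the association scheme extension algorithm (described in the context) outputs the unique coarsest $t$-extension $\mathfrak{X}_t:=\{\Gamma^s\}_{1\le s\le t}$ of $\mathfrak{X}$. That is, the output $\{\Gamma^s\}_{1\le s\le t}$ is a $t$-extension of $\mathfrak{X}$, and for any $t$-extension $\{\tilde\Gamma^s\}_{1\le s\le t}$ of $\mathfrak{X}$ and each $1\le s\le t$, the partition $\Gamma^s$ is a fusion of $\tilde\Gamma^s$.
   Context: $\mathbb{N}$ includes $0$; all members of a partition are nonempty. For partitions $\mathcal{P},\mathcal{R}$ of a finite nonempty set, $\mathcal{P}$ is a fusion of $\mathcal{R}$ if every member of $\mathcal{P}$ is a union of members of $\mathcal{R}$. Association scheme: for a finite nonempty set $Q$, a pair $\mathfrak{X}=(Q,\Gamma)$ where $\Gamma=\{C_1,\dots,C_s\}$ is a partition of $Q\times Q$ such that (A1) $C_1=\{(x,x)\mid x\in Q\}$; (A2) for every $C_i\in\Gamma$, $\{(y,x)\mid (x,y)\in C_i\}\in\Gamma$; (A3) for all $C_i,C_j,C_k\in\Gamma$ there is $c(i,j,k)\in\mathbb{N}$ with $|\{z\in Q\mid (x,z)\in C_i,\ (z,y)\in C_j\}|=c(i,j,k)$ for all $(x,y)\in C_k$. Notation: $\mathrm{pr}:Q^n\to Q^{n-1}$ deletes the last coordinate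 ($n>1$). For $\bar u=(u_1,\dots,u_n)\in Q^n$ and $\tau\in\mathrm{Symm}_n$ (symmetric group on $n$ elements), $\bar u^\tau:=(u_{\tau(1)},\dots,u_{\tau(n)})$, and $C^\tau:=\{\bar u^\tau\mid \bar u\in C\}$ for $C\subseteq Q^n$. $t$-prescheme (height $t$ presuperscheme) on $Q$, $t\in\mathbb{N}$: a family $\{\Gamma^n\}_{0\le n\le t}$, where $\Gamma^n=\{C^n_1,\dots,C^n_{s_n}\}$ is a partition of $Q^{n+2}$ into nonempty sets, such that (P1) $C^0_1=\{(x,x)\mid x\in Q\}$; (P2) for $1\le n\le t$ and $C\in\Gamma^n$, $\mathrm{pr}(C)\in\Gamma^{n-1}$; (P3) for $0\le n\le t$, $C\in\Gamma^n$, $\tau\in\mathrm{Symm}_{n+2}$, $C^\tau\in\Gamma^n$; (P4) for all $m,n\in\mathbb{N}$ with $m+n\le t$ and all $C^m_i\in\Gamma^m$, $C^n_j\in\Gamma^n$, $C^{m+n}_k\in\Gamma^{m+n}$ there is $c(i,j,k;m,n)\in\mathbb{N}$ such that for all $(x_0,\dots,x_m,y_0,\dots,y_n)\in C^{m+n}_k$, $|\{z\in Q\mid (x_0,\dots,x_m,z)\in C^m_i,\ (z,y_0,\dots,y_n)\in C^n_j\}|=c(i,j,k;m,n)$. An association scheme $\mathfrak{X}=(Q,\Gamma)$ is extensible to height $t$ if there is a $t$-prescheme $\{\Gamma^n\}_{0\le n\le t}$ on $Q$ with $\Gamma^0=\Gamma$; then $\{\Gamma^n\}_{1\le n\le t}$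 is called a $t$-extension of $\mathfrak{X}$. Tensors: for $C\subseteq Q^n$ ($n\ge2$), the adjacency tensor $A(C):Q^n\to\mathbb{Z}$ is the indicator function of $C$. For $E:Q^m\to\mathbb{Z}$, $F:Q^n\to\mathbb{Z}$, the inner product $EF:Q^{m+n-2}\to\mathbb{Z}$ is $(EF)_{i_1\cdots i_{m+n-2}}=\sum_{j=1}^d E_{i_1\cdots i_{m-1}j}F_{j\,i_m\cdots i_{m+n-2}}$. The association scheme extension algorithm. Input: an association scheme $\mathfrak{X}=(Q,\Gamma)$ on $Q=\{1,\dots,d\}$ and $t\in\mathbb{N}$ with $1\le t\le d-2$. Throughout, $\Gamma^0:=\Gamma$ (never modified), and whenever a set is replaced by several sets, empty ones are discarded. Initialization: for $1\le s\le t$ set $\Gamma^s:=\{Q^{s+2}\}$. Step 1: for each $1\le s\le t$ and each $C\in\Gamma^s$, determine whether $\mathrm{pr}(C)$ is a union $C^{s-1}_{i_1}\cup\dots\cup C^{s-1}_{i_k}$ of members of $\Gamma^{s-1}$. If yes, replace $C$ in $\Gamma^s$ by the sets $C\cap\mathrm{pr}^{-1}(C^{s-1}_{i_1}),\dots,C\cap\mathrm{pr}^{-1}(C^{s-1}_{i_k})$. If no and $s>1$, replace in $\Gamma^{s-1}$ each $C'$ with $C'\cap\mathrm{pr}(C)\ne\emptyset$ by $C'\cap\mathrm{pr}(C)$ and $C'\setminus\mathrm{pr}(C)$. If no and $s=1$, terminate and output "$\mathfrak{X}$ is not extensible to height $t$". Step 2: for each $1\le s\le t$, each $C\in\Gamma^s$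 and each $\tau\in\mathrm{Symm}_{s+2}$, replace in $\Gamma^s$ each $C'$ with $C'\cap C^\tau\ne\emptyset$ by $C'\cap C^\tau$ and $C'\setminus C^\tau$. Step 3: for each $1\le s\le t$, all $m,n\in\mathbb{N}$ with $m+n=s$, and all $C^m_i\in\Gamma^m$, $C^n_j\in\Gamma^n$, compute $P:=A(C^m_i)A(C^n_j)$; for each $r=0,\dots,d$ let $P^{-1}(r)$ be the set of tuples in $Q^{s+2}$ at which $P$ has entry $r$, and replace in $\Gamma^s$ each $C$ with $C\cap P^{-1}(r)\ne\emptyset$ by $C\cap P^{-1}(r)$ and $C\setminus P^{-1}(r)$. Repeat Steps 1-3. If none of them yields any further refinement of the partitions $\Gamma^s$ ($1\le s\le t$), terminate and output $\{\Gamma^s\}_{1\le s\le t}$. *)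

theory Defs
  imports
    Complex_Main
    "HOL-Library.Disjoint_Sets"
    "HOL-Library.Indicator_Function"
    "HOL-Library.NList"
    "HOL-Combinatorics.Multiset_Permutations"
begin

text \<open>
  Points of \<open>Q\<^sup>n\<close> are lists of length \<open>n\<close> over \<open>Q\<close>, so \<open>Q\<^sup>n\<close> is \<^term>\<open>nlists n Q\<close>; in particular
  \<open>Q \<times> Q\<close> is identified with \<open>Q\<^sup>2\<close> and a pair \<open>(x, y)\<close> is written \<^term>\<open>[x, y]\<close>. The projection \<open>pr\<close>
  is \<^const>\<open>butlast\<close>. Coordinates are numbered from \<open>0\<close>: a permutation in \<open>Symm\<^sub>n\<close> is a \<open>\<tau>\<close> that
  permutes \<^term>\<open>{..<n}\<close>, and \<open>u\<^sup>\<tau>\<close> is \<^term>\<open>permute_list \<tau> u\<close>.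
\<close>

definition fusion :: "'a set \<Rightarrow> 'a set set \<Rightarrow> 'a set set \<Rightarrow> bool" where
  "fusion A P R \<longleftrightarrow> partition_on A P \<and> partition_on A R \<and> (\<forall>X\<in>P. \<exists>S\<subseteq>R. X = \<Union>S)"

definition association_scheme :: "'a set \<Rightarrow> 'a list set set \<Rightarrow> bool" where
  "association_scheme Q \<Gamma> \<longleftrightarrow>
     finite Q \<and> Q \<noteq> {} \<and> partition_on (nlists 2 Q) \<Gamma> \<and>
     {[x, x] | x. x \<in> Q} \<in> \<Gamma> \<and>
     (\<forall>C\<in>\<Gamma>. {[y, x] | x y. [x, y] \<in> C} \<in> \<Gamma>) \<and>
     (\<forall>Ci\<in>\<Gamma>. \<forall>Cj\<in>\<Gamma>. \<forall>Ck\<in>\<Gamma>. \<exists>c::nat. \<forall>x y. [x, y] \<in> Ck \<longrightarrow>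
        card {z \<in> Q. [x, z] \<in> Ci \<and> [z, y] \<in> Cj} = c)"

text \<open>Only the values of the family at the indices \<open>0, \<dots>, t\<close> matter.\<close>

definition prescheme :: "'a set \<Rightarrow> nat \<Rightarrow> (nat \<Rightarrow> 'a list set set) \<Rightarrow> bool" where
  "prescheme Q t G \<longleftrightarrow>
     finite Q \<and> Q \<noteq> {} \<and>
     (\<forall>n\<le>t. partition_on (nlists (n + 2) Q) (G n)) \<and>
     {[x, x] | x. x \<in> Q} \<in> G 0 \<and>
     (\<forall>n\<in>{1..t}. \<forall>C\<in>G n. butlast ` C \<in> G (n - 1)) \<and>
     (\<forall>n\<le>t. \<forall>C\<in>G n. \<forall>\<tau>. \<tau> permutes {..<n + 2} \<longrightarrow> permute_list \<tau> ` C \<in> G n) \<and>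
     (\<forall>m n. m + n \<le> t \<longrightarrow>
        (\<forall>Ci\<in>G m. \<forall>Cj\<in>G n. \<forall>Ck\<in>G (m + n). \<exists>c::nat. \<forall>xs ys.
           length xs = m + 1 \<and> length ys = n + 1 \<and> xs @ ys \<in> Ck \<longrightarrow>
           card {z \<in> Q. xs @ [z] \<in> Ci \<and> z # ys \<in> Cj} = c))"

definition extensible :: "'a set \<Rightarrow> 'a list set set \<Rightarrow> nat \<Rightarrow> bool" where
  "extensible Q \<Gamma> t \<longleftrightarrow> (\<exists>G. prescheme Q t G \<and> G 0 = \<Gamma>)"

text \<open>A \<open>t\<close>-extension is indexed by \<open>1, \<dots>, t\<close>; whatever \<open>E\<close> is at \<open>0\<close> is replaced by \<open>\<Gamma>\<close>.\<close>

definition t_extension :: "'a set \<Rightarrow> 'a list set set \<Rightarrow> nat \<Rightarrow> (nat \<Rightarrow> 'a list set set) \<Rightarrow> bool" where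
  "t_extension Q \<Gamma> t E \<longleftrightarrow> prescheme Q t (E(0 := \<Gamma>))"

definition coarsest_t_extension ::
    "'a set \<Rightarrow> 'a list set set \<Rightarrow> nat \<Rightarrow> (nat \<Rightarrow> 'a list set set) \<Rightarrow> bool" where
  "coarsest_t_extension Q \<Gamma> t E \<longleftrightarrow>
     t_extension Q \<Gamma> t E \<and>
     (\<forall>E'. t_extension Q \<Gamma> t E' \<longrightarrow> (\<forall>s\<in>{1..t}. fusion (nlists (s + 2) Q) (E s) (E' s)))"

definition adjacency_tensor :: "'a list set \<Rightarrow> 'a list \<Rightarrow> int" where
  "adjacency_tensor C = indicator C"

text \<open>The parameter \<open>m\<close> is the order of the left factor \<open>E\<close>.\<close>

definition inner_product ::
    "'a set \<Rightarrow> nat \<Rightarrow> ('a list \<Rightarrow> int) \<Rightarrow> ('a list \<Rightarrow> int) \<Rightarrow> 'a list \<Rightarrow> int" where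
  "inner_product Q m E F u = (\<Sum>j\<in>Q. E (take (m - 1) u @ [j]) * F (j # drop (m - 1) u))"

text \<open>
  The order in which the loops run through their ranges is unspecified, so a program maps a state to
  the set of its possible results, where \<^term>\<open>None\<close> stands for an abort. A loop evaluates its range
  on entry and then visits every element exactly once, in any order.
\<close>

definition and_then :: "'st option set \<Rightarrow> ('st \<Rightarrow> 'st option set) \<Rightarrow> 'st option set" where
  "and_then R f = (\<Union>\<rho>\<in>R. case \<rho> of None \<Rightarrow> {None} | Some \<sigma> \<Rightarrow> f \<sigma>)"

primrec run_seq :: "('x \<Rightarrow> 'st \<Rightarrow> 'st option set) \<Rightarrow> 'x list \<Rightarrow> 'st \<Rightarrow> 'st option set" where
  "run_seq f [] \<sigma> = {Some \<sigma>}"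
| "run_seq f (x # xs) \<sigma> = and_then (f x \<sigma>) (run_seq f xs)"

definition for_each :: "'x set \<Rightarrow> ('x \<Rightarrow> 'st \<Rightarrow> 'st option set) \<Rightarrow> 'st \<Rightarrow> 'st option set" where
  "for_each S f \<sigma> = (\<Union>xs\<in>permutations_of_set S. run_seq f xs \<sigma>)"

type_synonym 'a family = "nat \<Rightarrow> 'a list set set"

definition split_by :: "'b set \<Rightarrow> 'b set set \<Rightarrow> 'b set set" where
  "split_by X P = (\<Union>C'\<in>P. if C' \<inter> X \<noteq> {} then {C' \<inter> X, C' - X} else {C'}) - {{}}"

definition init :: "'a set \<Rightarrow> 'a list set set \<Rightarrow> nat \<Rightarrow> 'a family" where
  "init Q \<Gamma> t = (\<lambda>s. if s = 0 then \<Gamma> else if s \<le> t then {nlists (s + 2) Q} else {})"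

definition project :: "nat \<Rightarrow> 'a list set \<Rightarrow> 'a family \<Rightarrow> 'a family option set" where
  "project s C G =
     (if \<exists>S\<subseteq>G (s - 1). butlast ` C = \<Union>S
      then {Some (G(s := ((G s - {C}) \<union> (\<lambda>D. C \<inter> butlast -` D) ` S) - {{}})) | S.
              S \<subseteq> G (s - 1) \<and> butlast ` C = \<Union>S}
      else if s > 1 then {Some (G(s - 1 := split_by (butlast ` C) (G (s - 1))))}
      else {None})"

definition step1 :: "nat \<Rightarrow> 'a family \<Rightarrow> 'a family option set" where
  "step1 t = for_each {1..t} (\<lambda>s G. for_each (G s) (project s) G)"

definition step2 :: "nat \<Rightarrow> 'a family \<Rightarrow> 'a family option set" where
  "step2 t = for_each {1..t} (\<lambda>s G.
     for_each (G s \<times> {\<tau>. \<tau> permutes {..<s + 2}})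
       (\<lambda>(C, \<tau>) H. {Some (H(s := split_by (permute_list \<tau> ` C) (H s)))}) G)"

definition step3 :: "'a set \<Rightarrow> nat \<Rightarrow> 'a family \<Rightarrow> 'a family option set" where
  "step3 Q t = for_each {1..t} (\<lambda>s.
     for_each {(m, n). m + n = s} (\<lambda>(m, n) G.
       for_each (G m \<times> G n) (\<lambda>(Ci, Cj).
         let P = inner_product Q (m + 2) (adjacency_tensor Ci) (adjacency_tensor Cj) in
         for_each {0..card Q} (\<lambda>r H.
           {Some (H(s := split_by {u \<in> nlists (s + 2) Q. P u = int r} (H s)))})) G))"

definition one_round :: "'a set \<Rightarrow> nat \<Rightarrow> 'a family \<Rightarrow> 'a family option set" where
  "one_round Q t G = and_then (and_then (step1 t G) (step2 t)) (step3 Q t)"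

datatype 'a outcome = Not_Extensible | Partitions "'a family"

text \<open>
  Every assignment in a round refines a partition, so a round without any refinement is one that
  returns the state it started from. \<open>outputs Q t G \<rho>\<close>: some execution from state \<open>G\<close> ends with
  output \<open>\<rho>\<close>.
\<close>

inductive outputs :: "'a set \<Rightarrow> nat \<Rightarrow> 'a family \<Rightarrow> 'a outcome \<Rightarrow> bool" for Q t where
  abort: "None \<in> one_round Q t G \<Longrightarrow> outputs Q t G Not_Extensible"
| stable: "Some G \<in> one_round Q t G \<Longrightarrow> outputs Q t G (Partitions G)"
| refined: "Some G' \<in> one_round Q t G \<Longrightarrow> G' \<noteq> G \<Longrightarrow> outputs Q t G' \<rho> \<Longrightarrow> outputs Q t G \<rho>"

text \<open>No execution from state \<open>G\<close> goes through infinitely many rounds.\<close>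

definition terminates :: "'a set \<Rightarrow> nat \<Rightarrow> 'a family \<Rightarrow> bool" where
  "terminates Q t G \<longleftrightarrow>
     \<not> (\<exists>f. f 0 = G \<and> (\<forall>i. Some (f (Suc i)) \<in> one_round Q t (f i) \<and> f (Suc i) \<noteq> f i))"

end

theory Submission
  imports Defs
begin

text \<open>
  Fix any \<open>t\<close>-prescheme \<open>T\<close> with \<open>T 0 = \<Gamma>\<close>. The proof rests on one invariant: at every moment of a
  run, each current partition of \<open>Q\<^sup>s\<^sup>+\<^sup>2\<close> is refined by \<open>T s\<close>. It holds at the start, where the
  partitions above \<open>\<Gamma>\<close> are trivial, and every cut made by the algorithm keeps it, because the set
  along which it cuts is a union of \<open>T\<close>-blocks: the axioms of a prescheme on projections, permuted
  coordinates and intersection numbers make projections, permuted copies and level sets of products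
  of unions of \<open>T\<close>-blocks unions of \<open>T\<close>-blocks again (\<open>saturated_image\<close>, \<open>saturated_level_set\<close>).
  In particular the projection of a block of level \<open>1\<close> is a union of members of \<open>\<Gamma>\<close>, so no run ever
  aborts.

  Every cut refines, and there are only finitely many states, so all runs terminate. They end in a
  state that a whole round maps to itself. Refinement is antisymmetric, so in such a round every
  single cut was idle (\<open>run_seq_safe\<close>), and a state on which all cuts are idle satisfies the axioms
  of a prescheme (\<open>stable_prescheme\<close>). Hence each possible result is a \<open>t\<close>-extension, and as \<open>T\<close> was
  arbitrary, it is coarser than all others. Two results of differently ordered loops are coarser
  than each other, hence equal, so the output does not depend on the order.
\<close>

section \<open>Partitions and unions of blocks\<close>

definition saturated :: "'b set set \<Rightarrow> 'b set \<Rightarrow> bool" where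
  "saturated R X \<longleftrightarrow> (\<forall>B\<in>R. B \<subseteq> X \<or> B \<inter> X = {})"

lemma saturatedD: "saturated R X \<Longrightarrow> B \<in> R \<Longrightarrow> x \<in> B \<Longrightarrow> x \<in> X \<Longrightarrow> B \<subseteq> X"
  unfolding saturated_def by blast

lemma partition_blocks_eq:
  assumes "partition_on A P" "B \<in> P" "C \<in> P" "x \<in> B" "x \<in> C"
  shows "B = C"
  using assms by (auto simp: partition_on_def disjoint_def)

lemma saturated_iff_Union:
  assumes "partition_on A R" "X \<subseteq> A"
  shows "saturated R X \<longleftrightarrow> (\<exists>S\<subseteq>R. X = \<Union>S)"
proof
  assume sat: "saturated R X"
  have "X = \<Union>{B \<in> R. B \<subseteq> X}"
  proof
    show "X \<subseteq> \<Union>{B \<in> R. B \<subseteq> X}"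
    proof
      fix x assume "x \<in> X"
      then obtain B where "B \<in> R" "x \<in> B"
        using assms partition_onD1 by blast
      then show "x \<in> \<Union>{B \<in> R. B \<subseteq> X}"
        using sat \<open>x \<in> X\<close> unfolding saturated_def by blast
    qed
  qed blast
  then show "\<exists>S\<subseteq>R. X = \<Union>S"
    by (intro exI[of _ "{B \<in> R. B \<subseteq> X}"]) auto
next
  assume "\<exists>S\<subseteq>R. X = \<Union>S"
  then show "saturated R X"
    using partition_blocks_eq[OF assms(1)] unfolding saturated_def by blast
qed

lemma refines_saturated:
  assumes "refines A R P" "X \<in> P"
  shows "saturated R X"
  using assms partition_blocks_eq[of A P] unfolding refines_def saturated_def by blast

lemma fusion_iff_refines: "fusion A P R \<longleftrightarrow> refines A R P"
proof
  assume F: "fusion A P R"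
  then have P: "partition_on A P" and R: "partition_on A R"
    and U: "\<And>X. X \<in> P \<Longrightarrow> \<exists>S\<subseteq>R. X = \<Union>S"
    unfolding fusion_def by auto
  have "\<exists>Y\<in>P. B \<subseteq> Y" if B: "B \<in> R" for B
  proof -
    obtain x where x: "x \<in> B"
      using partition_onD3[OF R] B by (metis ex_in_conv)
    then obtain Y where Y: "Y \<in> P" "x \<in> Y"
      using partition_onD1[OF P] partition_onD1[OF R] B by blast
    then have "saturated R Y"
      using U saturated_iff_Union[OF R, of Y] partition_onD1[OF P] by blast
    then show ?thesis
      using x Y B unfolding saturated_def by blast
  qed
  then show "refines A R P"
    using P R unfolding refines_def by blast
next
  assume "refines A R P"
  then have P: "partition_on A P" and R: "partition_on A R" and sat: "\<And>X. X \<in> P \<Longrightarrow> saturated R X"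
    using refines_saturated unfolding refines_def by auto
  have "\<exists>S\<subseteq>R. X = \<Union>S" if "X \<in> P" for X
    using saturated_iff_Union[OF R, of X] sat[OF that] that partition_onD1[OF P] by blast
  then show "fusion A P R"
    using P R unfolding fusion_def by blast
qed

text \<open>
  This transports unions of blocks through projections and coordinate permutations. It holds because
  images commute with unions and a block of \<open>R'\<close> that meets the image of a block equals it.
\<close>

lemma saturated_image:
  assumes "partition_on A R" "partition_on A' R'" "\<And>B. B \<in> R \<Longrightarrow> f ` B \<in> R'"
    and "X \<subseteq> A" "saturated R X"
  shows "saturated R' (f ` X)"
  unfolding saturated_def
proof
  fix B' assume "B' \<in> R'"
  show "B' \<subseteq> f ` X \<or> B' \<inter> f ` X = {}"
  proof (cases "B' \<inter> f ` X = {}")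
    case False
    then obtain x where x: "x \<in> X" "f x \<in> B'" by blast
    then obtain B where B: "B \<in> R" "x \<in> B"
      using assms partition_onD1 by blast
    then have "B \<subseteq> X"
      using assms(5) x unfolding saturated_def by blast
    moreover have "f ` B = B'"
      using partition_blocks_eq[OF assms(2) assms(3)[OF B(1)] \<open>B' \<in> R'\<close>, of "f x"] x B by blast
    ultimately show ?thesis by blast
  qed blast
qed

lemma in_split_by:
  "Y \<in> split_by X P \<longleftrightarrow> Y \<noteq> {} \<and> (\<exists>B\<in>P. Y = B \<inter> X \<or> Y = B - X)"
proof -
  have pieces: "Y \<in> (if B \<inter> X \<noteq> {} then {B \<inter> X, B - X} else {B}) \<and> Y \<noteq> {} \<longleftrightarrow>
        Y \<noteq> {} \<and> (Y = B \<inter> X \<or> Y = B - X)" for B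
  proof (cases "B \<inter> X = {}")
    case True
    then have "B - X = B" by blast
    with True show ?thesis by auto
  qed auto
  have union: "Y \<in> (\<Union>B\<in>P. F B) - {{}} \<longleftrightarrow> (\<exists>B\<in>P. Y \<in> F B \<and> Y \<noteq> {})"
    for F :: "'a set \<Rightarrow> 'a set set"
    by blast
  show ?thesis
    unfolding split_by_def union pieces by simp
qed

lemma in_split_byI:
  shows "B \<in> P \<Longrightarrow> B \<inter> X \<noteq> {} \<Longrightarrow> B \<inter> X \<in> split_by X P"
    and "B \<in> P \<Longrightarrow> B - X \<noteq> {} \<Longrightarrow> B - X \<in> split_by X P"
  by (metis in_split_by)+

lemma split_by_refines:
  assumes P: "partition_on A P"
  shows "refines A (split_by X P) P"
proof -
  have "partition_on A (split_by X P)"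
  proof (rule partition_onI)
    have "x \<in> \<Union>(split_by X P)" if x: "x \<in> A" for x
    proof -
      obtain B where "B \<in> P" "x \<in> B" using x partition_onD1[OF P] by blast
      then show ?thesis
        using in_split_byI[of B P X] by (cases "x \<in> X") blast+
    qed
    moreover have "\<Union>(split_by X P) \<subseteq> A"
      using partition_onD1[OF P] by (auto simp: in_split_by)
    ultimately show "\<Union>(split_by X P) = A" by blast
    show "disjnt p q" if pq: "p \<in> split_by X P" "q \<in> split_by X P" "p \<noteq> q" for p q
    proof -
      obtain B B' where "B \<in> P" "p = B \<inter> X \<or> p = B - X" "B' \<in> P" "q = B' \<inter> X \<or> q = B' - X"
        using pq unfolding in_split_by by metis
      then show ?thesis
        using pq(3) partition_blocks_eq[OF P, of B B'] unfolding disjnt_iff by auto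
    qed
  qed (simp add: in_split_by)
  moreover have "\<exists>B\<in>P. Y \<subseteq> B" if "Y \<in> split_by X P" for Y
    using that unfolding in_split_by by auto
  ultimately show ?thesis
    using P unfolding refines_def by blast
qed

lemma split_by_refines_saturated:
  assumes R: "refines A R P" and X: "saturated R X"
  shows "refines A R (split_by X P)"
proof -
  have "\<exists>Y\<in>split_by X P. B \<subseteq> Y" if B: "B \<in> R" for B
  proof -
    obtain Y where Y: "Y \<in> P" "B \<subseteq> Y" "B \<noteq> {}"
      using R B unfolding refines_def partition_on_def by metis
    consider "B \<subseteq> X" | "B \<inter> X = {}"
      using X B unfolding saturated_def by blast
    then show ?thesis
    proof cases
      case 1
      then have "Y \<inter> X \<in> split_by X P" "B \<subseteq> Y \<inter> X"
        using Y in_split_byI[of Y P X] by blast+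
      then show ?thesis by blast
    next
      case 2
      then have "Y - X \<in> split_by X P" "B \<subseteq> Y - X"
        using Y in_split_byI[of Y P X] by blast+
      then show ?thesis by blast
    qed
  qed
  then show ?thesis
    using R split_by_refines[of A P X] unfolding refines_def by blast
qed

lemma split_by_idle:
  assumes P: "partition_on A P" and idle: "split_by X P = P"
  shows "saturated P X"
  unfolding saturated_def
proof
  fix B assume B: "B \<in> P"
  show "B \<subseteq> X \<or> B \<inter> X = {}"
  proof (cases "B \<inter> X = {}")
    case False
    then have "B \<inter> X \<in> P"
      using B idle in_split_byI(1) by metis
    then have "B \<inter> X = B"
      using partition_blocks_eq[OF P _ B] False by blast
    then show ?thesis by blast
  qed blast
qed

lemma refines_replace_block:
  assumes P: "partition_on A P" and C: "C \<in> P" and D: "partition_on C D"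
  shows "refines A ((P - {C}) \<union> D) P"
proof -
  have "partition_on A ((P - {C}) \<union> D)"
  proof (rule partition_onI)
    show "\<Union>((P - {C}) \<union> D) = A"
      using partition_onD1[OF P] partition_onD1[OF D] C by blast
    show "{} \<notin> (P - {C}) \<union> D"
      using P D by (auto simp: partition_on_def)
    fix p q assume *: "p \<in> (P - {C}) \<union> D" "q \<in> (P - {C}) \<union> D" "p \<noteq> q"
    have "x \<notin> p \<or> x \<notin> q" for x
    proof (rule ccontr)
      assume "\<not> ?thesis"
      then have x: "x \<in> p" "x \<in> q" by auto
      moreover have "y = C" if "y \<in> P" "x \<in> y" "r \<in> D" "x \<in> r" for y r
        using partition_blocks_eq[OF P that(1) C that(2)] partition_onD1[OF D] that by blast
      ultimately show False
        using * partition_blocks_eq[OF P] partition_blocks_eq[OF D] by blast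
    qed
    then show "disjnt p q" unfolding disjnt_iff by blast
  qed
  then show ?thesis
    using P C partition_onD1[OF D] unfolding refines_def by blast
qed

section \<open>Nondeterministic loops that move along an order\<close>

text \<open>
  The relation \<open>le\<close> is an order on the set of admissible states \<open>{\<sigma>. le \<sigma> \<sigma>}\<close>, so that a single
  relation records both the invariant of a program and the direction in which it moves.
\<close>

locale descent =
  fixes le :: "'st \<Rightarrow> 'st \<Rightarrow> bool" (infix \<open>\<sqsubseteq>\<close> 50)
  assumes le_right: "\<sigma> \<sqsubseteq> \<sigma>' \<Longrightarrow> \<sigma>' \<sqsubseteq> \<sigma>'"
    and le_trans: "\<sigma> \<sqsubseteq> \<sigma>' \<Longrightarrow> \<sigma>' \<sqsubseteq> \<sigma>'' \<Longrightarrow> \<sigma> \<sqsubseteq> \<sigma>''"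
    and le_antisym: "\<sigma> \<sqsubseteq> \<sigma>' \<Longrightarrow> \<sigma>' \<sqsubseteq> \<sigma> \<Longrightarrow> \<sigma> = \<sigma>'"
begin

definition safe :: "'st \<Rightarrow> 'st option set \<Rightarrow> bool" where
  "safe \<sigma> \<R> \<longleftrightarrow> \<R> \<noteq> {} \<and> (\<forall>\<rho>\<in>\<R>. \<exists>\<sigma>'. \<rho> = Some \<sigma>' \<and> \<sigma> \<sqsubseteq> \<sigma>')"

lemma safe_SomeD: "safe \<sigma> \<R> \<Longrightarrow> Some \<sigma>' \<in> \<R> \<Longrightarrow> \<sigma> \<sqsubseteq> \<sigma>'"
  unfolding safe_def by blast

lemma safe_cases: "safe \<sigma> \<R> \<Longrightarrow> \<rho> \<in> \<R> \<Longrightarrow> \<exists>\<sigma>'. \<rho> = Some \<sigma>' \<and> \<sigma> \<sqsubseteq> \<sigma>'"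
  unfolding safe_def by blast

lemma safe_ex_Some: "safe \<sigma> \<R> \<Longrightarrow> \<exists>\<sigma>'. Some \<sigma>' \<in> \<R>"
  unfolding safe_def by (metis ex_in_conv)

lemma in_and_thenE:
  assumes "safe \<sigma> \<R>" "\<rho> \<in> and_then \<R> f"
  obtains \<sigma>' where "Some \<sigma>' \<in> \<R>" "\<rho> \<in> f \<sigma>'"
proof -
  obtain \<rho>' where \<rho>': "\<rho>' \<in> \<R>" "\<rho> \<in> (case \<rho>' of None \<Rightarrow> {None} | Some \<sigma> \<Rightarrow> f \<sigma>)"
    using assms(2) unfolding and_then_def by (rule UN_E)
  then show ?thesis
    using safe_cases[OF assms(1) \<rho>'(1)] that by auto
qed

lemma safe_and_then:
  assumes "safe \<sigma> \<R>" "\<And>\<sigma>'. Some \<sigma>' \<in> \<R> \<Longrightarrow> \<sigma>' \<sqsubseteq> \<sigma>' \<Longrightarrow> safe \<sigma>' (f \<sigma>')"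
  shows "safe \<sigma> (and_then \<R> f)"
proof -
  have f: "\<sigma> \<sqsubseteq> \<sigma>' \<and> safe \<sigma>' (f \<sigma>')" if "Some \<sigma>' \<in> \<R>" for \<sigma>'
    using safe_SomeD[OF assms(1) that] assms(2)[OF that] le_right by blast
  obtain \<sigma>1 where "Some \<sigma>1 \<in> \<R>"
    using safe_ex_Some[OF assms(1)] by blast
  with f obtain \<rho> where "\<rho> \<in> f \<sigma>1"
    using safe_ex_Some by blast
  with \<open>Some \<sigma>1 \<in> \<R>\<close> have "and_then \<R> f \<noteq> {}"
    unfolding and_then_def by force
  moreover have "\<exists>\<sigma>'. \<rho> = Some \<sigma>' \<and> \<sigma> \<sqsubseteq> \<sigma>'" if \<rho>: "\<rho> \<in> and_then \<R> f" for \<rho>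
  proof -
    obtain \<sigma>' where "Some \<sigma>' \<in> \<R>" "\<rho> \<in> f \<sigma>'"
      using in_and_thenE[OF assms(1) \<rho>] .
    then show ?thesis
      using f[of \<sigma>'] safe_cases[of \<sigma>' "f \<sigma>'" \<rho>] le_trans by blast
  qed
  ultimately show ?thesis unfolding safe_def by blast
qed

text \<open>
  Antisymmetry enters here. A composition of safe programs that returns to its initial state cannot
  have left it in between, since every program moves along the order.
\<close>

lemma and_then_idle:
  assumes "safe \<sigma> \<R>" "\<And>\<sigma>'. Some \<sigma>' \<in> \<R> \<Longrightarrow> \<sigma>' \<sqsubseteq> \<sigma>' \<Longrightarrow> safe \<sigma>' (f \<sigma>')"
    and "Some \<sigma> \<in> and_then \<R> f"
  shows "Some \<sigma> \<in> \<R> \<and> Some \<sigma> \<in> f \<sigma>"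
proof -
  obtain \<sigma>' where \<sigma>': "Some \<sigma>' \<in> \<R>" "Some \<sigma> \<in> f \<sigma>'"
    using in_and_thenE[OF assms(1,3)] .
  have "\<sigma> \<sqsubseteq> \<sigma>'"
    by (rule safe_SomeD[OF assms(1) \<sigma>'(1)])
  moreover from this have "\<sigma>' \<sqsubseteq> \<sigma>"
    using safe_SomeD[OF assms(2)[OF \<sigma>'(1)] \<sigma>'(2)] le_right by blast
  ultimately show ?thesis using \<sigma>' le_antisym by blast
qed

text \<open>
  The loop invariant \<open>J X \<sigma>\<close> depends on the set \<open>X\<close> of elements still to be visited, since a loop
  over the blocks of a partition that it modifies has to know that the blocks ahead are still blocks.
\<close>

lemma run_seq_safe:
  assumes adm: "\<And>X \<sigma>. J X \<sigma> \<Longrightarrow> \<sigma> \<sqsubseteq> \<sigma>"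
    and step: "\<And>x X \<sigma>. x \<notin> X \<Longrightarrow> J (insert x X) \<sigma> \<Longrightarrow>
                 safe \<sigma> (f x \<sigma>) \<and> (\<forall>\<sigma>'. Some \<sigma>' \<in> f x \<sigma> \<longrightarrow> J X \<sigma>')"
    and "distinct xs" "J (set xs) \<sigma>"
  shows "safe \<sigma> (run_seq f xs \<sigma>) \<and>
         (Some \<sigma> \<in> run_seq f xs \<sigma> \<longrightarrow> (\<forall>x\<in>set xs. Some \<sigma> \<in> f x \<sigma>))"
  using assms(3,4)
proof (induction xs arbitrary: \<sigma>)
  case Nil
  then show ?case using adm by (auto simp: safe_def)
next
  case (Cons x xs)
  then have x: "safe \<sigma> (f x \<sigma>)" "\<And>\<sigma>'. Some \<sigma>' \<in> f x \<sigma> \<Longrightarrow> J (set xs) \<sigma>'"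
    using step[of x "set xs" \<sigma>] by auto
  then have rest: "\<And>\<sigma>'. Some \<sigma>' \<in> f x \<sigma> \<Longrightarrow> safe \<sigma>' (run_seq f xs \<sigma>')"
    using Cons by auto
  have "Some \<sigma> \<in> f y \<sigma>" if "Some \<sigma> \<in> run_seq f (x # xs) \<sigma>" "y \<in> set (x # xs)" for y
  proof -
    have "Some \<sigma> \<in> f x \<sigma>" "Some \<sigma> \<in> run_seq f xs \<sigma>"
      using and_then_idle[OF x(1) rest] that(1) by auto
    then show ?thesis
      using Cons.IH[of \<sigma>] Cons.prems x(2) that(2) by auto
  qed
  then show ?case
    using safe_and_then[OF x(1) rest] by auto
qed

lemma for_each_safe_upto:
  assumes "finite S" "J S \<sigma>"
    and adm: "\<And>X \<sigma>. J X \<sigma> \<Longrightarrow> \<sigma> \<sqsubseteq> \<sigma>"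
    and step: "\<And>x X \<sigma>. x \<notin> X \<Longrightarrow> J (insert x X) \<sigma> \<Longrightarrow>
                 safe \<sigma> (f x \<sigma>) \<and> (\<forall>\<sigma>'. Some \<sigma>' \<in> f x \<sigma> \<longrightarrow> J X \<sigma>')"
  shows "safe \<sigma> (for_each S f \<sigma>)"
    and "Some \<sigma> \<in> for_each S f \<sigma> \<Longrightarrow> \<forall>x\<in>S. Some \<sigma> \<in> f x \<sigma>"
proof -
  have run: "safe \<sigma> (run_seq f xs \<sigma>) \<and>
         (Some \<sigma> \<in> run_seq f xs \<sigma> \<longrightarrow> (\<forall>x\<in>S. Some \<sigma> \<in> f x \<sigma>))"
    if "xs \<in> permutations_of_set S" for xs
    using run_seq_safe[where J = J and f = f and xs = xs and \<sigma> = \<sigma>, OF adm step] assms(2) that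
    by (auto simp: permutations_of_set_def)
  obtain xs where xs: "xs \<in> permutations_of_set S"
    using finite_distinct_list[OF assms(1)] by (auto simp: permutations_of_set_def)
  obtain \<sigma>' where "Some \<sigma>' \<in> run_seq f xs \<sigma>"
    using safe_ex_Some run[OF xs] by blast
  then have "Some \<sigma>' \<in> for_each S f \<sigma>"
    unfolding for_each_def by (rule UN_I[OF xs])
  moreover have "\<exists>\<sigma>'. \<rho> = Some \<sigma>' \<and> \<sigma> \<sqsubseteq> \<sigma>'" if "\<rho> \<in> for_each S f \<sigma>" for \<rho>
    using that run safe_cases unfolding for_each_def by blast
  ultimately show "safe \<sigma> (for_each S f \<sigma>)"
    unfolding safe_def by blast
  show "Some \<sigma> \<in> for_each S f \<sigma> \<Longrightarrow> \<forall>x\<in>S. Some \<sigma> \<in> f x \<sigma>"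
    using run unfolding for_each_def by blast
qed

lemma for_each_safe:
  assumes "finite S" "\<sigma> \<sqsubseteq> \<sigma>" "\<And>x \<sigma>. x \<in> S \<Longrightarrow> \<sigma> \<sqsubseteq> \<sigma> \<Longrightarrow> safe \<sigma> (f x \<sigma>)"
  shows "safe \<sigma> (for_each S f \<sigma>)"
    and "Some \<sigma> \<in> for_each S f \<sigma> \<Longrightarrow> \<forall>x\<in>S. Some \<sigma> \<in> f x \<sigma>"
proof -
  let ?J = "\<lambda>X \<sigma>. X \<subseteq> S \<and> \<sigma> \<sqsubseteq> \<sigma>"
  have "safe \<sigma> (f x \<sigma>) \<and> (\<forall>\<sigma>'. Some \<sigma>' \<in> f x \<sigma> \<longrightarrow> ?J X \<sigma>')" if "?J (insert x X) \<sigma>" for x X \<sigma>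
    using that assms(3)[of x \<sigma>] safe_SomeD le_right by blast
  note * = for_each_safe_upto[of S ?J \<sigma> f, OF assms(1) _ _ this]
  show "safe \<sigma> (for_each S f \<sigma>)"
    by (rule *(1)) (use assms(2) in auto)
  show "\<forall>x\<in>S. Some \<sigma> \<in> f x \<sigma>" if "Some \<sigma> \<in> for_each S f \<sigma>"
    by (rule *(2)) (use assms(2) that in auto)
qed

end

section \<open>The invariant: partitions coarser than a given prescheme\<close>

lemma inner_product_adjacency:
  assumes "finite Q" "length xs = m + 1"
  shows "inner_product Q (m + 2) (adjacency_tensor Ci) (adjacency_tensor Cj) (xs @ ys) =
           int (card {z \<in> Q. xs @ [z] \<in> Ci \<and> z # ys \<in> Cj})"
proof -
  have "inner_product Q (m + 2) (adjacency_tensor Ci) (adjacency_tensor Cj) (xs @ ys) =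
      (\<Sum>z\<in>Q. if xs @ [z] \<in> Ci \<and> z # ys \<in> Cj then 1 else 0)"
    using assms unfolding inner_product_def adjacency_tensor_def
    by (intro sum.cong) (auto simp: indicator_def)
  also have "\<dots> = int (card {z \<in> Q. xs @ [z] \<in> Ci \<and> z # ys \<in> Cj})"
    using assms by (simp flip: sum.inter_filter)
  finally show ?thesis .
qed

lemma finite_nlists: "finite Q \<Longrightarrow> finite (nlists n Q)"
  unfolding nlists_def using finite_lists_length_eq[of Q n] by (simp add: conj_commute)

locale prescheme_bound =
  fixes Q :: "'a set" and t :: nat and T :: "'a family"
  assumes T: "prescheme Q t T"
begin

text \<open>The last conjunct makes two admissible states equal once they agree on the levels up to \<open>t\<close>.\<close>

definition coarser :: "'a family \<Rightarrow> bool" where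
  "coarser G \<longleftrightarrow> G 0 = T 0 \<and> (\<forall>s\<le>t. refines (nlists (s + 2) Q) (T s) (G s)) \<and> (\<forall>s>t. G s = {})"

definition le :: "'a family \<Rightarrow> 'a family \<Rightarrow> bool" (infix \<open>\<sqsubseteq>\<close> 50) where
  "G \<sqsubseteq> H \<longleftrightarrow> coarser G \<and> coarser H \<and> (\<forall>s\<le>t. refines (nlists (s + 2) Q) (H s) (G s))"

lemma finite_Q: "finite Q"
  using T unfolding prescheme_def by blast

lemma Q_nonempty: "Q \<noteq> {}"
  using T unfolding prescheme_def by blast

lemma partition_T: "s \<le> t \<Longrightarrow> partition_on (nlists (s + 2) Q) (T s)"
  using T unfolding prescheme_def by simp

lemma butlast_T: "s \<in> {1..t} \<Longrightarrow> B \<in> T s \<Longrightarrow> butlast ` B \<in> T (s - 1)"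
  using T unfolding prescheme_def by simp

lemma permute_T: "s \<le> t \<Longrightarrow> B \<in> T s \<Longrightarrow> \<tau> permutes {..<s + 2} \<Longrightarrow> permute_list \<tau> ` B \<in> T s"
  using T unfolding prescheme_def by simp

lemma count_T:
  assumes "m + n \<le> t" "D \<in> T m" "D' \<in> T n" "B \<in> T (m + n)"
  shows "\<exists>c. \<forall>xs ys. length xs = m + 1 \<and> length ys = n + 1 \<and> xs @ ys \<in> B \<longrightarrow>
           card {z \<in> Q. xs @ [z] \<in> D \<and> z # ys \<in> D'} = c"
  using T assms unfolding prescheme_def by simp

lemma coarser_partition: "coarser G \<Longrightarrow> s \<le> t \<Longrightarrow> partition_on (nlists (s + 2) Q) (G s)"
  unfolding coarser_def refines_def by blast

lemma coarser_saturated: "coarser G \<Longrightarrow> s \<le> t \<Longrightarrow> C \<in> G s \<Longrightarrow> saturated (T s) C"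
  unfolding coarser_def by (meson refines_saturated)

lemma coarser_subset: "coarser G \<Longrightarrow> s \<le> t \<Longrightarrow> C \<in> G s \<Longrightarrow> C \<subseteq> nlists (s + 2) Q"
  using coarser_partition partition_onD1 by blast

lemma coarser_finite: "coarser G \<Longrightarrow> s \<le> t \<Longrightarrow> finite (G s)"
  using finite_elements[OF finite_nlists[OF finite_Q] coarser_partition] .

lemma le_refl_iff: "G \<sqsubseteq> G \<longleftrightarrow> coarser G"
  unfolding le_def using coarser_partition refines_refl by blast

sublocale descent le
proof
  fix F G H
  show "G \<sqsubseteq> G" if "F \<sqsubseteq> G"
    using that unfolding le_refl_iff by (simp add: le_def)
  show "F \<sqsubseteq> H" if "F \<sqsubseteq> G" "G \<sqsubseteq> H"
    using that refines_trans unfolding le_def by blast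
  show "F = G" if FG: "F \<sqsubseteq> G" "G \<sqsubseteq> F"
  proof
    fix s show "F s = G s"
    proof (cases "s \<le> t")
      case True
      then have "refines (nlists (s + 2) Q) (F s) (G s)" "refines (nlists (s + 2) Q) (G s) (F s)"
        using FG unfolding le_def by blast+
      then show ?thesis by (rule refines_asym)
    next
      case False
      then show ?thesis using FG unfolding le_def coarser_def by simp
    qed
  qed
qed

lemma le_update:
  assumes "coarser G" "s \<in> {1..t}"
    and "refines (nlists (s + 2) Q) (T s) P" "refines (nlists (s + 2) Q) P (G s)"
  shows "G \<sqsubseteq> G(s := P)"
  using assms coarser_partition[OF assms(1)]
  unfolding le_def coarser_def by (auto intro!: refines_refl)

lemma split_le:
  assumes "coarser G" "s \<in> {1..t}" "saturated (T s) X"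
  shows "G \<sqsubseteq> G(s := split_by X (G s))"
proof -
  have "s \<le> t" using assms(2) by simp
  then have "refines (nlists (s + 2) Q) (T s) (G s)"
    using assms(1) unfolding coarser_def by blast
  then show ?thesis
    using le_update[OF assms(1,2)] split_by_refines_saturated[OF _ assms(3)]
      split_by_refines[OF coarser_partition[OF assms(1) \<open>s \<le> t\<close>]] by blast
qed

lemma split_safe:
  assumes "coarser G" "s \<in> {1..t}" "saturated (T s) X"
  shows "safe G {Some (G(s := split_by X (G s)))}"
  using split_le[OF assms] unfolding safe_def by blast

lemma saturated_permute:
  assumes "s \<le> t" "saturated (T s) C" "C \<subseteq> nlists (s + 2) Q" "\<tau> permutes {..<s + 2}"
  shows "saturated (T s) (permute_list \<tau> ` C)"
  using saturated_image[OF partition_T[OF assms(1)] partition_T[OF assms(1)]]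
    permute_T[OF assms(1) _ assms(4)] assms(2,3) by blast

lemma saturated_butlast:
  assumes "s \<in> {1..t}" "saturated (T s) C" "C \<subseteq> nlists (s + 2) Q"
  shows "saturated (T (s - 1)) (butlast ` C)"
proof -
  have "s \<le> t" "s - 1 \<le> t" using assms(1) by auto
  then show ?thesis
    using saturated_image[OF partition_T[of s] partition_T[of "s - 1"]] butlast_T[OF assms(1)]
      assms(2,3) by blast
qed

text \<open>
  Entries of a product of two unions of \<open>T\<close>-blocks are sums of the intersection numbers of the
  blocks involved, and each of these is constant on the \<open>T\<close>-blocks.
\<close>

lemma card_constant_on_block:
  assumes mn: "m + n \<le> t"
    and Ci: "saturated (T m) Ci" "Ci \<subseteq> nlists (m + 2) Q"
    and Cj: "saturated (T n) Cj" "Cj \<subseteq> nlists (n + 2) Q"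
    and B: "B \<in> T (m + n)"
  shows "\<exists>c. \<forall>xs ys. length xs = m + 1 \<and> length ys = n + 1 \<and> xs @ ys \<in> B \<longrightarrow>
           card {z \<in> Q. xs @ [z] \<in> Ci \<and> z # ys \<in> Cj} = c"
proof -
  obtain S where S: "S \<subseteq> T m" "Ci = \<Union>S"
    using Ci saturated_iff_Union[OF partition_T[of m]] mn by auto
  obtain S' where S': "S' \<subseteq> T n" "Cj = \<Union>S'"
    using Cj saturated_iff_Union[OF partition_T[of n]] mn by auto
  have fin: "finite S" "finite S'"
    using S S' mn finite_elements[OF finite_nlists[OF finite_Q] partition_T]
    by (meson finite_subset add_leE)+
  let ?N = "\<lambda>xs ys (D, D'). {z \<in> Q. xs @ [z] \<in> D \<and> z # ys \<in> D'}"
  have sum: "card {z \<in> Q. xs @ [z] \<in> Ci \<and> z # ys \<in> Cj} = (\<Sum>p\<in>S \<times> S'. card (?N xs ys p))" for xs ys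
  proof -
    have "{z \<in> Q. xs @ [z] \<in> Ci \<and> z # ys \<in> Cj} = (\<Union>p\<in>S \<times> S'. ?N xs ys p)"
      using S S' by auto
    moreover have "?N xs ys p \<inter> ?N xs ys q = {}" if pq: "p \<in> S \<times> S'" "q \<in> S \<times> S'" "p \<noteq> q" for p q
    proof (rule ccontr)
      assume "\<not> ?thesis"
      then obtain z where z: "z \<in> ?N xs ys p" "z \<in> ?N xs ys q" by blast
      obtain D D' E E' where eqs: "p = (D, D')" "q = (E, E')" by (cases p, cases q)
      have "m \<le> t" "n \<le> t" using mn by auto
      then have "D = E" "D' = E'"
        using partition_blocks_eq[OF partition_T[of m], of D E "xs @ [z]"]
          partition_blocks_eq[OF partition_T[of n], of D' E' "z # ys"] z pq(1,2) S(1) S'(1)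
        unfolding eqs by auto
      then show False using pq(3) eqs by blast
    qed
    moreover have "finite (?N xs ys p)" for p
      using finite_Q by (auto split: prod.splits)
    ultimately show ?thesis
      using fin by (simp add: card_UN_disjoint)
  qed
  have "\<forall>p\<in>S \<times> S'. \<exists>c. \<forall>xs ys. length xs = m + 1 \<and> length ys = n + 1 \<and> xs @ ys \<in> B \<longrightarrow>
      card (?N xs ys p) = c"
    using count_T[OF mn _ _ B] S(1) S'(1) by fast
  then obtain c where c: "\<And>p xs ys. p \<in> S \<times> S' \<Longrightarrow>
      length xs = m + 1 \<and> length ys = n + 1 \<and> xs @ ys \<in> B \<Longrightarrow> card (?N xs ys p) = c p"
    unfolding bchoice_iff by blast
  show ?thesis
    using c by (intro exI[of _ "\<Sum>p\<in>S \<times> S'. c p"]) (auto simp: sum intro!: sum.cong)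
qed

lemma saturated_level_set:
  assumes mn: "m + n \<le> t"
    and "saturated (T m) Ci" "Ci \<subseteq> nlists (m + 2) Q"
    and "saturated (T n) Cj" "Cj \<subseteq> nlists (n + 2) Q"
  shows "saturated (T (m + n)) {u \<in> nlists (m + n + 2) Q.
           inner_product Q (m + 2) (adjacency_tensor Ci) (adjacency_tensor Cj) u = int r}"
  unfolding saturated_def
proof
  let ?P = "inner_product Q (m + 2) (adjacency_tensor Ci) (adjacency_tensor Cj)"
  fix B assume B: "B \<in> T (m + n)"
  then have sub: "B \<subseteq> nlists (m + n + 2) Q"
    using partition_onD1[OF partition_T[OF mn]] by blast
  obtain c where c: "\<And>xs ys. length xs = m + 1 \<Longrightarrow> length ys = n + 1 \<Longrightarrow> xs @ ys \<in> B \<Longrightarrow>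
      card {z \<in> Q. xs @ [z] \<in> Ci \<and> z # ys \<in> Cj} = c"
    using card_constant_on_block[OF assms B] by blast
  have "?P u = int c" if "u \<in> B" for u
  proof -
    have "length u = m + n + 2" using that sub by auto
    then show ?thesis
      using that c[of "take (m + 1) u" "drop (m + 1) u"]
        inner_product_adjacency[OF finite_Q, of "take (m + 1) u" m Ci Cj "drop (m + 1) u"] by simp
  qed
  then show "B \<subseteq> {u \<in> nlists (m + n + 2) Q. ?P u = int r} \<or>
             B \<inter> {u \<in> nlists (m + n + 2) Q. ?P u = int r} = {}"
    using sub by (cases "c = r") auto
qed

section \<open>Rounds are safe, and idle rounds certify the axioms\<close>

lemma pieces_partition:
  assumes "partition_on A P" "S \<subseteq> P" "f ` C = \<Union>S"
  shows "partition_on C ((\<lambda>D. C \<inter> f -` D) ` S - {{}})"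
proof (rule partition_onI)
  show "\<Union>((\<lambda>D. C \<inter> f -` D) ` S - {{}}) = C"
  proof
    show "C \<subseteq> \<Union>((\<lambda>D. C \<inter> f -` D) ` S - {{}})"
    proof
      fix x assume "x \<in> C"
      then obtain D where "D \<in> S" "x \<in> C \<inter> f -` D"
        using assms(3) by blast
      then show "x \<in> \<Union>((\<lambda>D. C \<inter> f -` D) ` S - {{}})"
        by (intro UnionI[of "C \<inter> f -` D"]) auto
    qed
  qed auto
  show "disjnt p q"
    if "p \<in> (\<lambda>D. C \<inter> f -` D) ` S - {{}}" "q \<in> (\<lambda>D. C \<inter> f -` D) ` S - {{}}" "p \<noteq> q" for p q
    using that partition_blocks_eq[OF assms(1)] assms(2) unfolding disjnt_iff by blast
qed blast

lemma butlast_subset: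
  assumes "coarser G" "s \<in> {1..t}" "C \<in> G s"
  shows "butlast ` C \<subseteq> nlists (s - 1 + 2) Q"
proof -
  have s: "s - 1 + 2 = s + 2 - 1" "s \<le> t" using assms(2) by auto
  have "butlast u \<in> nlists (s - 1 + 2) Q" if "u \<in> nlists (s + 2) Q" for u
    using that unfolding s(1) nlists_def by (auto dest: in_set_butlastD)
  then show ?thesis
    using coarser_subset[OF assms(1) s(2) assms(3)] by blast
qed

text \<open>
  In the affirmative case the pieces of \<open>C\<close> still contain whole \<open>T\<close>-blocks: a \<open>T\<close>-block projects onto a
  \<open>T\<close>-block, which lies in one block of the level below. The second part keeps the blocks that the
  surrounding loop has yet to visit.
\<close>

lemma project_safe:
  assumes G: "coarser G" and s: "s \<in> {1..t}" and C: "C \<in> G s"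
  shows "safe G (project s C G)"
    and "Some H \<in> project s C G \<Longrightarrow> G s - {C} \<subseteq> H s"
proof -
  have s1: "s - 1 \<le> t" "s \<le> t" "s - 1 + 2 = s + 1" using s by auto
  have P: "partition_on (nlists (s + 2) Q) (G s)" "partition_on (nlists (s - 1 + 2) Q) (G (s - 1))"
    using coarser_partition[OF G] s1 by blast+
  have sat: "saturated (T (s - 1)) (butlast ` C)"
    using saturated_butlast[OF s] coarser_saturated[OF G] coarser_subset[OF G] C s1 by blast
  have yes: "G \<sqsubseteq> G(s := ((G s - {C}) \<union> (\<lambda>D. C \<inter> butlast -` D) ` S) - {{}})"
    if S: "S \<subseteq> G (s - 1)" "butlast ` C = \<Union>S" for S
  proof -
    let ?D = "(\<lambda>D. C \<inter> butlast -` D) ` S - {{}}"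
    have eq: "((G s - {C}) \<union> (\<lambda>D. C \<inter> butlast -` D) ` S) - {{}} = (G s - {C}) \<union> ?D"
      using partition_onD3[OF P(1)] by blast
    have ref: "refines (nlists (s + 2) Q) ((G s - {C}) \<union> ?D) (G s)"
      using refines_replace_block[OF P(1) C pieces_partition[OF P(2) S]] .
    have "\<exists>Y\<in>(G s - {C}) \<union> ?D. B \<subseteq> Y" if B: "B \<in> T s" for B
    proof -
      have T_ref: "refines (nlists (s + 2) Q) (T s) (G s)"
          "refines (nlists (s - 1 + 2) Q) (T (s - 1)) (G (s - 1))"
        using G s1 unfolding coarser_def by blast+
      then obtain Y where Y: "Y \<in> G s" "B \<subseteq> Y" "B \<noteq> {}"
        using B unfolding refines_def partition_on_def by metis
      have "butlast ` B \<in> T (s - 1)"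
        by (rule butlast_T[OF s B])
      then obtain Z where Z: "Z \<in> G (s - 1)" "butlast ` B \<subseteq> Z"
        using T_ref(2) unfolding refines_def by blast
      show ?thesis
      proof (cases "Y = C")
        case True
        obtain x where "x \<in> B" using Y by blast
        then obtain D where D: "D \<in> S" "butlast x \<in> D"
          using S(2) Y True by blast
        then have "D = Z"
          using partition_blocks_eq[OF P(2) _ Z(1)] S(1) Z(2) \<open>x \<in> B\<close> by blast
        then have "B \<subseteq> C \<inter> butlast -` D"
          using Y True Z by blast
        with D \<open>x \<in> B\<close> show ?thesis by blast
      qed (use Y in blast)
    qed
    then have "refines (nlists (s + 2) Q) (T s) ((G s - {C}) \<union> ?D)"
      using ref partition_T[OF s1(2)] unfolding refines_def by blast
    then show ?thesis
      unfolding eq using le_update[OF G s _ ref] by blast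
  qed
  show "safe G (project s C G)"
  proof (cases "\<exists>S\<subseteq>G (s - 1). butlast ` C = \<Union>S")
    case True
    then show ?thesis using yes unfolding safe_def project_def by auto
  next
    case False
    \<comment> \<open>At level \<open>1\<close> the answer is always yes: there the partition below is \<open>T 0\<close> itself.\<close>
    have "s \<noteq> 1"
    proof
      assume "s = 1"
      moreover have "butlast ` C \<subseteq> nlists (s - 1 + 2) Q"
        by (rule butlast_subset[OF G s C])
      ultimately show False
        using False sat saturated_iff_Union[OF partition_T[OF s1(1)]] G
        unfolding coarser_def by auto
    qed
    then have s2: "1 < s" and "s - 1 \<in> {1..t}" using s by auto
    then show ?thesis
      unfolding project_def if_not_P[OF False] if_P[OF s2] using split_safe[OF G _ sat] by blast
  qed
  show "G s - {C} \<subseteq> H s" if "Some H \<in> project s C G"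
    using that s partition_onD3[OF P(1)] unfolding project_def by (auto split: if_splits)
qed

lemma project_idle:
  assumes G: "coarser G" and s: "s \<in> {1..t}" and C: "C \<in> G s"
    and idle: "Some G \<in> project s C G"
  shows "butlast ` C \<in> G (s - 1)"
proof (cases "\<exists>S\<subseteq>G (s - 1). butlast ` C = \<Union>S")
  case True
  with idle obtain S where S: "S \<subseteq> G (s - 1)" "butlast ` C = \<Union>S"
    and eq: "G = G(s := ((G s - {C}) \<union> (\<lambda>D. C \<inter> butlast -` D) ` S) - {{}})"
    unfolding project_def by auto
  from fun_cong[OF eq, of s] have "C \<in> (\<lambda>D. C \<inter> butlast -` D) ` S"
    using C by auto
  then obtain D where "D \<in> S" "C \<subseteq> butlast -` D" by blast
  then have "butlast ` C = D" using S by blast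
  then show ?thesis using S \<open>D \<in> S\<close> by blast
next
  case False
  \<comment> \<open>An idle cut along the projection would make it a union of blocks after all.\<close>
  then have "s > 1" and eq: "G = G(s - 1 := split_by (butlast ` C) (G (s - 1)))"
    using idle unfolding project_def by (auto split: if_splits)
  have s1: "s - 1 \<le> t" "s \<le> t" "s - 1 + 2 = s + 1" using s by auto
  have "saturated (G (s - 1)) (butlast ` C)"
    using split_by_idle[OF coarser_partition[OF G s1(1)]] fun_cong[OF eq, of "s - 1"] by simp
  moreover have "butlast ` C \<subseteq> nlists (s - 1 + 2) Q"
    by (rule butlast_subset[OF G s C])
  ultimately show ?thesis
    using False saturated_iff_Union[OF coarser_partition[OF G s1(1)]] by blast
qed

lemma step1_safe:
  assumes G: "coarser G"
  shows "safe G (step1 t G)"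
    and "Some G \<in> step1 t G \<Longrightarrow> s \<in> {1..t} \<Longrightarrow> C \<in> G s \<Longrightarrow> butlast ` C \<in> G (s - 1)"
proof -
  have inner: "safe H (for_each (H s) (project s) H)"
      "Some H \<in> for_each (H s) (project s) H \<Longrightarrow> \<forall>C\<in>H s. Some H \<in> project s C H"
    if s: "s \<in> {1..t}" and H: "H \<sqsubseteq> H" for H s
  proof -
    let ?J = "\<lambda>X F. F \<sqsubseteq> F \<and> X \<subseteq> F s"
    have step: "safe F (project s C F) \<and> (\<forall>F'. Some F' \<in> project s C F \<longrightarrow> ?J X F')"
      if "C \<notin> X" "?J (insert C X) F" for C X F
    proof -
      have C: "coarser F" "C \<in> F s" using that by (auto simp: le_refl_iff)
      note * = project_safe[OF C(1) s C(2)]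
      have "?J X F'" if "Some F' \<in> project s C F" for F'
        using *(2)[OF that] le_right[OF safe_SomeD[OF *(1) that]] \<open>C \<notin> X\<close> \<open>?J (insert C X) F\<close>
        by blast
      then show ?thesis using *(1) by blast
    qed
    have "finite (H s)" "?J (H s) H"
      using coarser_finite H s by (auto simp: le_refl_iff)
    note * = for_each_safe_upto[of "H s" ?J H "project s", OF this _ step]
    show "safe H (for_each (H s) (project s) H)"
      by (rule *(1)) auto
    show "\<forall>C\<in>H s. Some H \<in> project s C H" if "Some H \<in> for_each (H s) (project s) H"
      by (rule *(2)) (use that in auto)
  qed
  have GG: "G \<sqsubseteq> G" using G by (simp add: le_refl_iff)
  note outer = for_each_safe[of "{1..t}" G "\<lambda>s G. for_each (G s) (project s) G", OF _ GG inner(1)]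
  show "safe G (step1 t G)"
    unfolding step1_def by (rule outer(1)) auto
  assume "Some G \<in> step1 t G" "s \<in> {1..t}" "C \<in> G s"
  then have "Some G \<in> project s C G"
    using outer(2) inner(2)[OF _ GG, of s] unfolding step1_def by blast
  then show "butlast ` C \<in> G (s - 1)"
    using project_idle G \<open>s \<in> {1..t}\<close> \<open>C \<in> G s\<close> by blast
qed

lemma fun_upd_idle: "f = f(x := y) \<Longrightarrow> y = f x"
  by (metis fun_upd_same)

lemma step2_safe:
  assumes G: "coarser G"
  shows "safe G (step2 t G)"
    and "Some G \<in> step2 t G \<Longrightarrow> s \<in> {1..t} \<Longrightarrow> C \<in> G s \<Longrightarrow> \<tau> permutes {..<s + 2} \<Longrightarrow>
           saturated (G s) (permute_list \<tau> ` C)"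
proof -
  let ?f = "\<lambda>s (C, \<tau>) H. {Some (H(s := split_by (permute_list \<tau> ` C) (H s)))}"
  let ?S = "\<lambda>s G. G s \<times> {\<tau>. \<tau> permutes {..<s + 2}}"
  have body: "safe H (?f s p H)"
    if F: "F \<sqsubseteq> F" and s: "s \<in> {1..t}" and p: "p \<in> ?S s F" and H: "H \<sqsubseteq> H" for s p F H
  proof -
    obtain C \<tau> where p_eq: "p = (C, \<tau>)" by (cases p)
    have "saturated (T s) (permute_list \<tau> ` C)"
      using saturated_permute[of s C \<tau>] coarser_saturated[of F s C] coarser_subset[of F s C] F p s
      by (auto simp: le_refl_iff p_eq)
    then show ?thesis
      using split_safe H s by (simp add: p_eq le_refl_iff)
  qed
  have fin: "finite (?S s F)" if "F \<sqsubseteq> F" "s \<in> {1..t}" for s F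
    using that coarser_finite[of F s] finite_permutations[of "{..<s + 2}"] by (auto simp: le_refl_iff)
  have inner: "safe F (for_each (?S s F) (?f s) F)"
      "Some F \<in> for_each (?S s F) (?f s) F \<Longrightarrow> \<forall>p\<in>?S s F. Some F \<in> ?f s p F"
    if s: "s \<in> {1..t}" and F: "F \<sqsubseteq> F" for F s
    using for_each_safe[of "?S s F" F "?f s", OF fin[OF F s] F body[OF F s]] by blast+
  have GG: "G \<sqsubseteq> G" using G by (simp add: le_refl_iff)
  note outer = for_each_safe[of "{1..t}" G "\<lambda>s G. for_each (?S s G) (?f s) G", OF _ GG inner(1)]
  show "safe G (step2 t G)"
    unfolding step2_def by (rule outer(1)) auto
  assume "Some G \<in> step2 t G" and s: "s \<in> {1..t}" and "C \<in> G s" "\<tau> permutes {..<s + 2}"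
  then have "Some G \<in> ?f s (C, \<tau>) G"
    using outer(2) inner(2)[OF s GG] unfolding step2_def by blast
  then have "G = G(s := split_by (permute_list \<tau> ` C) (G s))" by simp
  from fun_upd_idle[OF this] show "saturated (G s) (permute_list \<tau> ` C)"
    using split_by_idle[OF coarser_partition[OF G]] s by simp
qed

lemma step3_safe:
  assumes G: "coarser G"
  shows "safe G (step3 Q t G)"
    and "Some G \<in> step3 Q t G \<Longrightarrow> m + n \<in> {1..t} \<Longrightarrow> Ci \<in> G m \<Longrightarrow> Cj \<in> G n \<Longrightarrow> r \<le> card Q \<Longrightarrow>
           saturated (G (m + n)) {u \<in> nlists (m + n + 2) Q.
             inner_product Q (m + 2) (adjacency_tensor Ci) (adjacency_tensor Cj) u = int r}"
proof -
  let ?X = "\<lambda>s m Ci Cj r. {u \<in> nlists (s + 2) Q.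
      inner_product Q (m + 2) (adjacency_tensor Ci) (adjacency_tensor Cj) u = int r}"
  let ?cut = "\<lambda>s m Ci Cj r H. {Some (H(s := split_by (?X s m Ci Cj r) (H s)))}"
  let ?pair = "\<lambda>s m (Ci, Cj). for_each {0..card Q} (?cut s m Ci Cj)"
  let ?mn = "\<lambda>s (m, n) F. for_each (F m \<times> F n) (?pair s m) F"
  let ?level = "\<lambda>s. for_each {(m, n). m + n = s} (?mn s)"
  have step3_eq: "step3 Q t = for_each {1..t} ?level"
    by (simp add: step3_def Let_def)
  have pair: "safe H (?pair s m p H)"
      "Some H \<in> ?pair s m p H \<Longrightarrow> \<forall>r\<in>{0..card Q}. Some H \<in> ?cut s m (fst p) (snd p) r H"
    if F: "F \<sqsubseteq> F" and s: "s \<in> {1..t}" "m + n = s" and p: "p \<in> F m \<times> F n" and H: "H \<sqsubseteq> H"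
    for s m n p F H
  proof -
    obtain Ci Cj where p_eq: "p = (Ci, Cj)" by (cases p)
    have "saturated (T s) (?X s m Ci Cj r)" for r
      using saturated_level_set[of m n Ci Cj r] coarser_saturated[of F] coarser_subset[of F] F p s
      by (auto simp: le_refl_iff p_eq)
    then have "safe H' (?cut s m Ci Cj r H')" if "r \<in> {0..card Q}" "H' \<sqsubseteq> H'" for H' r
      using that(2) s(1) split_safe[of H' s] unfolding le_refl_iff by blast
    note * = for_each_safe[of "{0..card Q}" H "?cut s m Ci Cj", OF finite_atLeastAtMost H this]
    show "safe H (?pair s m p H)"
      unfolding p_eq prod.case by (rule *(1))
    show "\<forall>r\<in>{0..card Q}. Some H \<in> ?cut s m (fst p) (snd p) r H" if run: "Some H \<in> ?pair s m p H"
      unfolding p_eq fst_conv snd_conv by (rule *(2)[OF _ _ run[unfolded p_eq prod.case]])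
  qed
  have mn: "safe F (?mn s q F)"
      "Some F \<in> ?mn s q F \<Longrightarrow> \<forall>p\<in>F (fst q) \<times> F (snd q). Some F \<in> ?pair s (fst q) p F"
    if s: "s \<in> {1..t}" and q: "q \<in> {(m, n). m + n = s}" and F: "F \<sqsubseteq> F" for F s q
  proof -
    obtain m n where q_eq: "q = (m, n)" by (cases q)
    have sum: "m + n = s" using q q_eq by auto
    have "finite (F m \<times> F n)"
      using F s sum coarser_finite[of F] by (auto simp: le_refl_iff)
    note * = for_each_safe[of "F m \<times> F n" F "?pair s m", OF this F pair(1)[OF F s sum]]
    show "safe F (?mn s q F)"
      unfolding q_eq prod.case by (rule *(1))
    show "\<forall>p\<in>F (fst q) \<times> F (snd q). Some F \<in> ?pair s (fst q) p F" if run: "Some F \<in> ?mn s q F"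
      unfolding q_eq fst_conv snd_conv by (rule *(2)[OF _ _ run[unfolded q_eq prod.case]])
  qed
  have fin: "finite {(m, n). m + n = s}" for s :: nat
    by (rule finite_subset[of _ "{..s} \<times> {..s}"]) auto
  have level: "safe F (?level s F)"
      "Some F \<in> ?level s F \<Longrightarrow> \<forall>q\<in>{(m, n). m + n = s}. Some F \<in> ?mn s q F"
    if s: "s \<in> {1..t}" and F: "F \<sqsubseteq> F" for F s
    using for_each_safe[of "{(m, n). m + n = s}" F "?mn s", OF fin F mn(1)[OF s]] by blast+
  have GG: "G \<sqsubseteq> G" using G by (simp add: le_refl_iff)
  note outer = for_each_safe[of "{1..t}" G ?level, OF _ GG level(1)]
  show "safe G (step3 Q t G)"
    unfolding step3_eq by (rule outer(1)) auto
  assume *: "Some G \<in> step3 Q t G" "m + n \<in> {1..t}" "Ci \<in> G m" "Cj \<in> G n" "r \<le> card Q"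
  have "Some G \<in> ?level (m + n) G"
    using outer(2) * unfolding step3_eq by blast
  then have "Some G \<in> ?mn (m + n) (m, n) G"
    using level(2)[OF *(2) GG] by blast
  then have "Some G \<in> ?pair (m + n) m (Ci, Cj) G"
    using mn(2)[OF *(2) _ GG, of "(m, n)"] *(3,4) by auto
  then have "Some G \<in> ?cut (m + n) m Ci Cj r G"
    using pair(2)[OF GG *(2) refl, of "(Ci, Cj)" G] GG *(3-5) by auto
  then have "G = G(m + n := split_by (?X (m + n) m Ci Cj r) (G (m + n)))" by simp
  from fun_upd_idle[OF this] show "saturated (G (m + n)) (?X (m + n) m Ci Cj r)"
    using split_by_idle[OF coarser_partition[OF G]] *(2) by simp
qed

lemma one_round_safe:
  assumes G: "coarser G"
  shows "safe G (one_round Q t G)"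
    and "Some G \<in> one_round Q t G \<Longrightarrow>
           Some G \<in> step1 t G \<and> Some G \<in> step2 t G \<and> Some G \<in> step3 Q t G"
proof -
  have 12: "safe G (and_then (step1 t G) (step2 t))"
    using safe_and_then[OF step1_safe(1)[OF G]] step2_safe(1) by (simp add: le_refl_iff)
  show "safe G (one_round Q t G)"
    unfolding one_round_def using safe_and_then[OF 12] step3_safe(1) by (simp add: le_refl_iff)
  assume "Some G \<in> one_round Q t G"
  then have "Some G \<in> and_then (step1 t G) (step2 t)" "Some G \<in> step3 Q t G"
    unfolding one_round_def using and_then_idle[OF 12] step3_safe(1) by (auto simp: le_refl_iff)
  then show "Some G \<in> step1 t G \<and> Some G \<in> step2 t G \<and> Some G \<in> step3 Q t G"
    using and_then_idle[OF step1_safe(1)[OF G]] step2_safe(1) by (auto simp: le_refl_iff)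
qed

text \<open>
  The copy of \<open>C\<close> contains a whole block \<open>B\<close>. Taken back by the inverse permutation, \<open>B\<close> is a union of
  blocks inside \<open>C\<close>, hence all of \<open>C\<close>.
\<close>

lemma saturated_permute_block:
  assumes P: "partition_on (nlists n Q) P" and C: "C \<in> P" and \<tau>: "\<tau> permutes {..<n}"
    and sat: "\<And>C \<tau>. C \<in> P \<Longrightarrow> \<tau> permutes {..<n} \<Longrightarrow> saturated P (permute_list \<tau> ` C)"
  shows "permute_list \<tau> ` C \<in> P"
proof -
  have len: "length x = n" if "x \<in> B" "B \<in> P" for x B
    using that partition_onD1[OF P] nlistsE_length by (metis UnionI)
  have inv_left: "permute_list (inv \<tau>) (permute_list \<tau> x) = x"
    and inv_right: "permute_list \<tau> (permute_list (inv \<tau>) x) = x" if "length x = n" for x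
  proof -
    show "permute_list (inv \<tau>) (permute_list \<tau> x) = x"
      using permute_list_compose[of "inv \<tau>" x \<tau>] permutes_inv[OF \<tau>] that
        permutes_inv_o(1)[OF \<tau>] by simp
    show "permute_list \<tau> (permute_list (inv \<tau>) x) = x"
      using permute_list_compose[of \<tau> x "inv \<tau>"] \<tau> that permutes_inv_o(2)[OF \<tau>] by simp
  qed
  obtain x where x: "x \<in> C"
    using C partition_onD3[OF P] by (cases "C = {}") auto
  have "x \<in> nlists n Q"
    using x C partition_onD1[OF P] by blast
  then have "set (permute_list \<tau> x) \<subseteq> Q"
    using set_permute_list[of \<tau> x] \<tau> len[OF x C] nlistsE_set[of x n Q] by simp
  then have "permute_list \<tau> x \<in> nlists n Q"
    using len[OF x C] by (intro nlistsI) simp_all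
  then obtain B where B: "B \<in> P" "permute_list \<tau> x \<in> B"
    using partition_onD1[OF P] by blast
  then have "B \<subseteq> permute_list \<tau> ` C"
    using saturatedD[OF sat[OF C \<tau>]] x by blast
  moreover have "permute_list \<tau> ` C \<subseteq> B"
  proof -
    have "x \<in> permute_list (inv \<tau>) ` B"
      using B(2) inv_left[OF len[OF x C]] by (metis imageI)
    then have "C \<subseteq> permute_list (inv \<tau>) ` B"
      by (rule saturatedD[OF sat[OF B(1) permutes_inv[OF \<tau>]] C x])
    then show ?thesis
      using inv_right len[OF _ B(1)] by fastforce
  qed
  ultimately have "B = permute_list \<tau> ` C" by (rule subset_antisym)
  then show ?thesis using B(1) by simp
qed

text \<open>
  The axioms at the levels handled by the algorithm follow from idleness of its three steps. Those that
  only involve \<open>\<Gamma>\<close> are inherited from \<open>T 0 = \<Gamma>\<close>.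
\<close>

lemma stable_prescheme:
  assumes G: "coarser G" and stable: "Some G \<in> one_round Q t G"
  shows "prescheme Q t G"
proof -
  have steps: "Some G \<in> step1 t G" "Some G \<in> step2 t G" "Some G \<in> step3 Q t G"
    using one_round_safe(2)[OF G stable] by auto
  have G0: "G 0 = T 0" using G unfolding coarser_def by blast
  have P3: "permute_list \<tau> ` C \<in> G n" if "n \<le> t" "C \<in> G n" "\<tau> permutes {..<n + 2}" for n C \<tau>
  proof (cases "n = 0")
    case True
    then show ?thesis using that permute_T[of n C \<tau>] by (simp add: G0)
  next
    case False
    then show ?thesis
      using saturated_permute_block[OF coarser_partition[OF G that(1)] that(2,3)]
        step2_safe(2)[OF G steps(2)] that(1) by auto
  qed
  have P4: "\<exists>c. \<forall>xs ys. length xs = m + 1 \<and> length ys = n + 1 \<and> xs @ ys \<in> Ck \<longrightarrow>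
           card {z \<in> Q. xs @ [z] \<in> Ci \<and> z # ys \<in> Cj} = c"
    if mn: "m + n \<le> t" and C: "Ci \<in> G m" "Cj \<in> G n" "Ck \<in> G (m + n)" for m n Ci Cj Ck
  proof (cases "m + n = 0")
    case True
    then have mn0: "m = 0" "n = 0" by auto
    show ?thesis
      using count_T[of 0 0 Ci Cj Ck] C unfolding mn0 by (simp add: G0)
  next
    case False
    let ?P = "inner_product Q (m + 2) (adjacency_tensor Ci) (adjacency_tensor Cj)"
    let ?c = "\<lambda>xs ys. card {z \<in> Q. xs @ [z] \<in> Ci \<and> z # ys \<in> Cj}"
    have const: "?c xs ys = ?c xs' ys'"
      if "length xs = m + 1" "xs @ ys \<in> Ck" "length xs' = m + 1" "xs' @ ys' \<in> Ck" for xs ys xs' ys'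
    proof -
      \<comment> \<open>The algorithm cuts along the level sets of \<open>0, \<dots>, |Q|\<close> only, which covers every entry.\<close>
      have "?c xs ys \<le> card Q" by (rule card_mono[OF finite_Q]) auto
      then have sat: "saturated (G (m + n)) {u \<in> nlists (m + n + 2) Q. ?P u = int (?c xs ys)}"
        using step3_safe(2)[OF G steps(3) _ C(1,2)] mn False by auto
      have mem: "xs @ ys \<in> {u \<in> nlists (m + n + 2) Q. ?P u = int (?c xs ys)}"
        using coarser_subset[OF G mn C(3)] that inner_product_adjacency[OF finite_Q that(1)] by auto
      then have "xs' @ ys' \<in> {u \<in> nlists (m + n + 2) Q. ?P u = int (?c xs ys)}"
        using subsetD[OF saturatedD[OF sat C(3) that(2) mem] that(4)] by simp
      then show ?thesis
        using inner_product_adjacency[OF finite_Q that(3)] by simp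
    qed
    show ?thesis
    proof (cases "\<exists>xs ys. length xs = m + 1 \<and> xs @ ys \<in> Ck")
      case True
      then obtain xs ys where "length xs = m + 1" "xs @ ys \<in> Ck" by blast
      then show ?thesis
        using const by (intro exI[of _ "?c xs ys"]) blast
    qed blast
  qed
  show ?thesis
    unfolding prescheme_def
  proof (intro conjI)
    show "finite Q" "Q \<noteq> {}" "{[x, x] | x. x \<in> Q} \<in> G 0"
      using T unfolding prescheme_def G0 by blast+
    show "\<forall>n\<le>t. partition_on (nlists (n + 2) Q) (G n)"
      using coarser_partition[OF G] by blast
    show "\<forall>n\<in>{1..t}. \<forall>C\<in>G n. butlast ` C \<in> G (n - 1)"
      using step1_safe(2)[OF G steps(1)] by blast
  qed (use P3 P4 in blast)+
qed

section \<open>Termination and the possible outputs\<close>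

definition refinement_steps :: "('a family \<times> 'a family) set" where
  "refinement_steps = {(H, G). G \<sqsubseteq> H \<and> H \<noteq> G}"

lemma wf_refinement_steps: "wf refinement_steps"
proof (rule finite_acyclic_wf)
  let ?B = "\<Union>s\<le>t. Pow (Pow (nlists (s + 2) Q))"
  have "finite ?B" using finite_nlists[OF finite_Q] by blast
  then have "finite {f. \<forall>s. (s \<in> {..t} \<longrightarrow> f s \<in> ?B) \<and> (s \<notin> {..t} \<longrightarrow> f s = {})}"
    by (intro finite_set_of_finite_funs finite_atMost)
  moreover have "G s \<in> ?B" if "coarser G" "s \<le> t" for G s
    using coarser_subset[OF that] that(2) by blast
  then have "{G. coarser G} \<subseteq> {f. \<forall>s. (s \<in> {..t} \<longrightarrow> f s \<in> ?B) \<and> (s \<notin> {..t} \<longrightarrow> f s = {})}"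
    by (auto simp: coarser_def simp del: UN_iff)
  ultimately have "finite {G. coarser G}"
    by (rule rev_finite_subset)
  moreover have "refinement_steps \<subseteq> {G. coarser G} \<times> {G. coarser G}"
    unfolding refinement_steps_def le_def by blast
  ultimately show "finite refinement_steps"
    using finite_subset by blast
  have "trans refinement_steps"
    unfolding refinement_steps_def trans_def using le_trans le_antisym by blast
  then show "acyclic refinement_steps"
    by (simp add: acyclic_def refinement_steps_def)
qed

lemma one_round_step:
  assumes "coarser G" "Some H \<in> one_round Q t G"
  shows "coarser H" and "H \<noteq> G \<Longrightarrow> (H, G) \<in> refinement_steps"
  using safe_SomeD[OF one_round_safe(1)[OF assms(1)] assms(2)]
  unfolding refinement_steps_def le_def by blast+

lemma coarser_terminates:
  assumes "coarser G"
  shows "terminates Q t G"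
  unfolding terminates_def
proof
  assume "\<exists>f. f 0 = G \<and> (\<forall>i. Some (f (Suc i)) \<in> one_round Q t (f i) \<and> f (Suc i) \<noteq> f i)"
  then obtain f where f: "f 0 = G"
    "\<And>i. Some (f (Suc i)) \<in> one_round Q t (f i)" "\<And>i. f (Suc i) \<noteq> f i" by blast
  have coarse: "coarser (f i)" for i
  proof (induction i)
    case (Suc i)
    then show ?case by (rule one_round_step(1)[OF _ f(2)])
  qed (use assms f(1) in simp)
  have "(f (Suc i), f i) \<in> refinement_steps" for i
    using one_round_step(2)[OF coarse f(2) f(3)] .
  then show False
    using wf_refinement_steps unfolding wf_iff_no_infinite_down_chain by blast
qed

lemma coarser_has_output:
  assumes "coarser G"
  shows "\<exists>\<rho>. outputs Q t G \<rho>"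
  using wf_refinement_steps assms
proof (induction G rule: wf_induct_rule)
  case (less G)
  obtain H where H: "Some H \<in> one_round Q t G"
    using safe_ex_Some[OF one_round_safe(1)[OF less.prems]] by blast
  show ?case
  proof (cases "H = G")
    case True
    then show ?thesis using H outputs.stable by blast
  next
    case False
    then obtain \<rho> where "outputs Q t H \<rho>"
      using less.IH one_round_step[OF less.prems H] by blast
    then show ?thesis using outputs.refined[OF H False] by blast
  qed
qed

lemma output_stable:
  assumes "outputs Q t G \<rho>" "coarser G"
  shows "\<exists>E. \<rho> = Partitions E \<and> coarser E \<and> Some E \<in> one_round Q t E"
  using assms
proof induction
  case (abort G)
  then show ?case using safe_cases[OF one_round_safe(1)[OF abort(2)] abort(1)] by blast
next
  case (stable G)
  then show ?case by blast
next
  case (refined G' G \<rho>)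
  then show ?case using one_round_step(1)[OF refined.prems refined.hyps(1)] by blast
qed

lemma coarser_init: "coarser (init Q (T 0) t)"
proof -
  have ne: "nlists n Q \<noteq> {}" for n
    using nlists_not_empty[OF Q_nonempty, of n] by blast
  have "refines (nlists (s + 2) Q) (T s) (init Q (T 0) t s)" if "s \<le> t" for s
  proof (cases "s = 0")
    case True
    then show ?thesis
      using refines_refl[OF partition_T[OF that]] by (simp add: init_def)
  next
    case False
    have "refines (nlists (s + 2) Q) (T s) {nlists (s + 2) Q}"
      using partition_T[OF that] partition_on_space[OF ne[of "s + 2"]]
        partition_onD1[OF partition_T[OF that]] unfolding refines_def by blast
    then show ?thesis using False that by (simp add: init_def)
  qed
  then show ?thesis
    unfolding coarser_def by (simp add: init_def)
qed

end

text \<open>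
  The output is fixed before the prescheme \<open>T\<close> is chosen, so the invariant may be read off for every
  \<open>T\<close> over \<open>\<Gamma>\<close>, and reading it for \<open>E'(0 := \<Gamma>)\<close> compares the output with the extension \<open>E'\<close>.
\<close>

lemma output_is_coarsest:
  assumes out: "outputs Q t (init Q \<Gamma> t) \<rho>" and ext: "extensible Q \<Gamma> t"
  obtains E where "\<rho> = Partitions E" "coarsest_t_extension Q \<Gamma> t E" "E 0 = \<Gamma>" "\<forall>s>t. E s = {}"
proof -
  have stable: "\<exists>E. \<rho> = Partitions E \<and> prescheme Q t E \<and> prescheme_bound.coarser Q t T E"
    if "prescheme Q t T" "T 0 = \<Gamma>" for T
  proof -
    interpret prescheme_bound Q t T by unfold_locales fact
    show ?thesis
      using output_stable[OF out] coarser_init stable_prescheme that(2) by blast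
  qed
  have coarserD: "E 0 = T 0" "\<And>s. s \<le> t \<Longrightarrow> refines (nlists (s + 2) Q) (T s) (E s)"
      "\<forall>s>t. E s = {}"
    if "prescheme Q t T" "prescheme_bound.coarser Q t T E" for T E
    using that prescheme_bound.coarser_def[OF prescheme_bound.intro[OF that(1)]] by auto
  obtain T where T: "prescheme Q t T" "T 0 = \<Gamma>"
    using ext unfolding extensible_def by blast
  obtain E where E: "\<rho> = Partitions E" "prescheme Q t E" "prescheme_bound.coarser Q t T E"
    using stable[OF T] by blast
  have E0: "E 0 = \<Gamma>" "\<forall>s>t. E s = {}"
    using coarserD[OF T(1) E(3)] T(2) by auto
  have "fusion (nlists (s + 2) Q) (E s) (E' s)"
    if E': "t_extension Q \<Gamma> t E'" and s: "s \<in> {1..t}" for E' s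
  proof -
    have pre: "prescheme Q t (E'(0 := \<Gamma>))"
      using E' unfolding t_extension_def .
    then have "prescheme_bound.coarser Q t (E'(0 := \<Gamma>)) E"
      using stable[of "E'(0 := \<Gamma>)"] E(1) by auto
    then show ?thesis
      using coarserD(2)[OF pre, of E s] s unfolding fusion_iff_refines by auto
  qed
  then have "coarsest_t_extension Q \<Gamma> t E"
    using E(2) fun_upd_triv[of E 0] E0(1)
    unfolding coarsest_t_extension_def t_extension_def by simp
  with E(1) E0 show ?thesis using that by blast
qed

lemma coarsest_t_extension_unique:
  assumes "coarsest_t_extension Q \<Gamma> t E" "coarsest_t_extension Q \<Gamma> t E'" "s \<in> {1..t}"
  shows "E s = E' s"
  using assms refines_asym unfolding coarsest_t_extension_def fusion_iff_refines by blast

theorem corollary4p3: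
  fixes d t :: nat and \<Gamma> :: "nat list set set"
  assumes "association_scheme {1..d} \<Gamma>"
    and "1 \<le> t" and "t \<le> d - 2"
    and "extensible {1..d} \<Gamma> t"
  shows "terminates {1..d} t (init {1..d} \<Gamma> t) \<and>
    (\<exists>E. (\<forall>\<rho>. outputs {1..d} t (init {1..d} \<Gamma> t) \<rho> \<longleftrightarrow> \<rho> = Partitions E) \<and>
         coarsest_t_extension {1..d} \<Gamma> t E \<and>
         (\<forall>E'. coarsest_t_extension {1..d} \<Gamma> t E' \<longrightarrow> (\<forall>s\<in>{1..t}. E' s = E s)))"
proof -
  let ?start = "init {1..d} \<Gamma> t"
  obtain T where pre: "prescheme {1..d} t T" "T 0 = \<Gamma>"
    using assms(4) unfolding extensible_def by blast
  then interpret prescheme_bound "{1..d}" t T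
    by unfold_locales
  have start: "coarser ?start"
    using coarser_init pre(2) by simp
  obtain \<rho> where \<rho>: "outputs {1..d} t ?start \<rho>"
    using coarser_has_output[OF start] by blast
  obtain E where E: "\<rho> = Partitions E" "coarsest_t_extension {1..d} \<Gamma> t E"
      "E 0 = \<Gamma>" "\<forall>s>t. E s = {}"
    using output_is_coarsest[OF \<rho> assms(4)] .
  have same: "\<rho>' = Partitions E" if out: "outputs {1..d} t ?start \<rho>'" for \<rho>'
  proof -
    obtain E' where E': "\<rho>' = Partitions E'" "coarsest_t_extension {1..d} \<Gamma> t E'"
        "E' 0 = \<Gamma>" "\<forall>s>t. E' s = {}"
      using output_is_coarsest[OF out assms(4)] .
    have "E' s = E s" for s
    proof -
      consider "s = 0" | "s \<in> {1..t}" | "s > t" by fastforce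
      then show ?thesis
        using E(3,4) E'(3,4) coarsest_t_extension_unique[OF E'(2) E(2)] by cases simp_all
    qed
    then show ?thesis using E'(1) by auto
  qed
  show ?thesis
    using coarser_terminates[OF start] same \<rho> E(1,2) coarsest_t_extension_unique by metis
qed

end
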